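(* Let $\alpha\in\mathbb{R}$, $\beta>0$, $T>0$, $\Omega=[\alpha,\alpha+\beta]\times[0,T]$, let $a,g\in C(\Omega)$, $u_0\in C([\alpha,\alpha+\beta])$, and let $K\in C(\Omega^2\times\mathbb{R})$ satisfy a Lipschitz condition with respect to its last variable with Lipschitz constant $M$. Let $\{A_n\}_{n\ge 1}$ be a Schauder basis of $C(\Omega)$ with associated sequence of projections $\{Q_n\}_{n\ge1}$, and let $\{B_n\}_{n\ge 1}$ be a Schauder basis of $C(\Omega^2)$ with associated sequence of projections $\{R_n\}_{n\ge1}$. Let $u$ be the unique solution of the problem: $u\in C(\Omega)$, $\frac{\partial u}{\partial t}\in C(\Omega)$, and $$\frac{\partial u(x,t)}{\partial t}=a(x,t)u(x,t)+g(x,t)+\int_0^t\int_\alpha^x K(x,t,y,s,u(y,s))\,dy\,ds,\qquad u(x,0)=u_0(x),$$ for $(x,t)\in\Omega$. Then for each $\varepsilon>0$ and each $\widetilde{u}\in C(\Omega)$ there exist an integer $m\ge 1$ and integers $n_1,\dots,n_m\ge 1$ such that $$\|u-G_m\circ\cdots\circ G_1(\widetilde{u})\|<\varepsilon,$$ where, for $p=1,\dots,m$, the map $G_p:C(\Omega)\to C(\Omega)$ is defined from $n_p$ by $$(G_p v)(x,t)=u_0(x)+\int_0^t Q_{n_p^2}(a\cdot v)(x,r)\,dr+\int_0^t g(x,r)\,dr+\int_0^t\int_0^r\int_\alpha^x R_{n_p^4}(L_0(v))(x,r,y,s)\,dy\,ds\,dr$$ for $v\in C(\Omega)$ and $(x,t)\in\Omega$,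 and $L_0:C(\Omega)\to C(\Omega^2)$ is given by $L_0(v)(x,t,y,s)=K(x,t,y,s,v(y,s))$.
   Context: $C(\Omega)$, $C(\Omega^2)$, $C([\alpha,\alpha+\beta])$ are spaces of real-valued continuous functions; $C(\Omega)$ and $C(\Omega^2)$ are Banach spaces with the sup norm $\|\cdot\|$. The Lipschitz condition on $K$ means $|K(x,t,y,s,w_1)-K(x,t,y,s,w_2)|\le M|w_1-w_2|$ for all $(x,t,y,s)\in\Omega^2$ and $w_1,w_2\in\mathbb{R}$. Under these assumptions the problem has exactly one solution $u$. A Schauder basis of a Banach space $X$ is a sequence $\{\psi_n\}_{n\ge1}$ in $X$ such that every $z\in X$ has a unique sequence of scalars $\{\lambda_n\}_{n\ge 1}$ with $z=\sum_{n\ge1}\lambda_n\psi_n$ (norm convergence). Its associated projections are $P_n:X\to X$, $P_n\left(\sum_{k\ge1}\lambda_k\psi_k\right)=\sum_{k=1}^n\lambda_k\psi_k$. Here $Q_n$ and $R_n$ are the projections $P_n$ for the bases $\{A_n\}$ and $\{B_n\}$ respectively. $a\cdot v$ is the pointwise product, and $n_p^2$, $n_p^4$ are powers of the integer $n_p$. *)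

theory Defs
  imports "HOL-Analysis.Analysis"
begin

text \<open>
  An element of \<open>C(S)\<close> is represented by a total function that is continuous on \<open>S\<close>. Its values
  outside \<open>S\<close> are irrelevant: nothing below depends on them. The supremum norm and Schauder bases
  are only meant for compact \<open>S\<close>, where the supremum is finite.
\<close>

definition cont_space :: "'a::topological_space set \<Rightarrow> ('a \<Rightarrow> real) set" where
  "cont_space S = {f. continuous_on S f}"

definition sup_norm :: "'a set \<Rightarrow> ('a \<Rightarrow> real) \<Rightarrow> real" where
  "sup_norm S f = (SUP x\<in>S. \<bar>f x\<bar>)"

text \<open>
  Sequences are indexed from 0, so that \<open>\<psi> k\<close> and \<open>c k\<close> are the mathematical
  \<open>\<psi>\<close> and \<open>\<lambda>\<close> with index \<open>k + 1\<close>. The sum over \<open>k < n\<close> is then the sum of the first \<open>n\<close> terms,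
  and the index of a projection is the usual one.
\<close>

definition schauder_expansion ::
    "'a set \<Rightarrow> (nat \<Rightarrow> 'a \<Rightarrow> real) \<Rightarrow> ('a \<Rightarrow> real) \<Rightarrow> (nat \<Rightarrow> real) \<Rightarrow> bool" where
  "schauder_expansion S \<psi> z c \<longleftrightarrow>
     (\<lambda>n. sup_norm S (\<lambda>x. z x - (\<Sum>k<n. c k * \<psi> k x))) \<longlonglongrightarrow> 0"

definition schauder_basis ::
    "'a::topological_space set \<Rightarrow> (nat \<Rightarrow> 'a \<Rightarrow> real) \<Rightarrow> bool" where
  "schauder_basis S \<psi> \<longleftrightarrow>
     (\<forall>k. \<psi> k \<in> cont_space S) \<and>
     (\<forall>z\<in>cont_space S. \<exists>!c. schauder_expansion S \<psi> z c)"

definition schauder_proj ::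
    "'a set \<Rightarrow> (nat \<Rightarrow> 'a \<Rightarrow> real) \<Rightarrow> nat \<Rightarrow> ('a \<Rightarrow> real) \<Rightarrow> 'a \<Rightarrow> real" where
  "schauder_proj S \<psi> n z = (\<lambda>x. \<Sum>k<n. (THE c. schauder_expansion S \<psi> z c) k * \<psi> k x)"

definition Omega :: "real \<Rightarrow> real \<Rightarrow> real \<Rightarrow> (real \<times> real) set" where
  "Omega \<alpha> \<beta> T = {\<alpha>..\<alpha> + \<beta>} \<times> {0..T}"

text \<open>
  The kernel value \<open>K(x,t,y,s,w)\<close> is written \<open>K (((x, t), (y, s)), w)\<close>. The partial derivative
  in \<open>t\<close> is one-sided at \<open>t = 0\<close> and \<open>t = T\<close>.
\<close>

definition is_solution ::
    "real \<Rightarrow> real \<Rightarrow> real \<Rightarrow> (real \<times> real \<Rightarrow> real) \<Rightarrow> (real \<times> real \<Rightarrow> real) \<Rightarrow> (real \<Rightarrow> real) \<Rightarrow>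
     (((real \<times> real) \<times> (real \<times> real)) \<times> real \<Rightarrow> real) \<Rightarrow> (real \<times> real \<Rightarrow> real) \<Rightarrow> bool" where
  "is_solution \<alpha> \<beta> T a g u0 K u \<longleftrightarrow>
     u \<in> cont_space (Omega \<alpha> \<beta> T) \<and>
     (\<exists>ut\<in>cont_space (Omega \<alpha> \<beta> T).
        \<forall>(x, t)\<in>Omega \<alpha> \<beta> T.
          ((\<lambda>\<tau>. u (x, \<tau>)) has_real_derivative ut (x, t)) (at t within {0..T}) \<and>
          ut (x, t) = a (x, t) * u (x, t) + g (x, t) +
            integral {0..t} (\<lambda>s. integral {\<alpha>..x} (\<lambda>y. K (((x, t), (y, s)), u (y, s))))) \<and>
     (\<forall>x\<in>{\<alpha>..\<alpha> + \<beta>}. u (x, 0) = u0 x)"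

definition L0 ::
    "(((real \<times> real) \<times> (real \<times> real)) \<times> real \<Rightarrow> real) \<Rightarrow> (real \<times> real \<Rightarrow> real) \<Rightarrow>
     (real \<times> real) \<times> (real \<times> real) \<Rightarrow> real" where
  "L0 K v = (\<lambda>((x, t), (y, s)). K (((x, t), (y, s)), v (y, s)))"

definition G_op ::
    "real \<Rightarrow> real \<Rightarrow> real \<Rightarrow> (real \<times> real \<Rightarrow> real) \<Rightarrow> (real \<times> real \<Rightarrow> real) \<Rightarrow> (real \<Rightarrow> real) \<Rightarrow>
     (((real \<times> real) \<times> (real \<times> real)) \<times> real \<Rightarrow> real) \<Rightarrow>
     (nat \<Rightarrow> real \<times> real \<Rightarrow> real) \<Rightarrow> (nat \<Rightarrow> (real \<times> real) \<times> (real \<times> real) \<Rightarrow> real) \<Rightarrow>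
     nat \<Rightarrow> (real \<times> real \<Rightarrow> real) \<Rightarrow> real \<times> real \<Rightarrow> real" where
  "G_op \<alpha> \<beta> T a g u0 K A B n v = (\<lambda>(x, t).
     u0 x
     + integral {0..t} (\<lambda>r. schauder_proj (Omega \<alpha> \<beta> T) A (n ^ 2) (\<lambda>z. a z * v z) (x, r))
     + integral {0..t} (\<lambda>r. g (x, r))
     + integral {0..t} (\<lambda>r. integral {0..r} (\<lambda>s. integral {\<alpha>..x} (\<lambda>y.
         schauder_proj (Omega \<alpha> \<beta> T \<times> Omega \<alpha> \<beta> T) B (n ^ 4) (L0 K v) ((x, r), (y, s))))))"

end

theory Submission
  imports Defs
begin

text \<open>
  The solution \<open>u\<close> is the fixed point of the Volterra operator \<open>G\<close> obtained from \<open>G\<^sub>p\<close> by deleting the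
  projections. In the weighted norm \<open>sup \<bar>v (x, t)\<bar> / exp (\<Lambda> t)\<close> with \<open>\<Lambda>\<close> large, \<open>G\<close> contracts by \<open>1/2\<close>.
  The projections converge pointwise, so for each single \<open>v\<close> the value \<open>G\<^sub>p v\<close> is as close to \<open>G v\<close> as
  desired once \<open>n\<^sub>p\<close> is large. Choosing \<open>n\<^sub>1, n\<^sub>2, \<dots>\<close> one after the other, each step maps an error \<open>D\<close> to
  at most \<open>D/2 + \<eta>\<close>, and after \<open>m\<close> steps the error is at most \<open>D/2^m + 2\<eta>\<close>.
\<close>

section \<open>Supremum norm and convergence of Schauder projections\<close>

lemma abs_le_sup_norm:
  assumes "compact S" "continuous_on S f" "x \<in> S"
  shows "\<bar>f x\<bar> \<le> sup_norm S f"
proof -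
  have "compact ((\<lambda>x. \<bar>f x\<bar>) ` S)"
    using assms by (intro compact_continuous_image continuous_intros)
  then have "bdd_above ((\<lambda>x. \<bar>f x\<bar>) ` S)"
    by (intro bounded_imp_bdd_above compact_imp_bounded)
  with assms(3) show ?thesis
    unfolding sup_norm_def by (rule cSUP_upper)
qed

lemma continuous_on_schauder_proj:
  assumes "schauder_basis S \<psi>"
  shows "continuous_on S (schauder_proj S \<psi> n z)"
  unfolding schauder_proj_def
  by (intro continuous_intros) (use assms in \<open>auto simp: schauder_basis_def cont_space_def\<close>)

text \<open>Uniqueness of the coefficients makes the \<open>THE\<close> in
  \<open>schauder_proj\<close> denote the actual expansion, so the error of the projection is the
  remainder of a norm-convergent series. The convergence is for one fixed \<open>z\<close>;
  \<open>n\<close> may depend on it.\<close>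

lemma schauder_proj_approx:
  assumes "compact S" "schauder_basis S \<psi>" "continuous_on S z" "\<delta> > 0"
  shows "\<forall>\<^sub>F n in sequentially. \<forall>x\<in>S. \<bar>z x - schauder_proj S \<psi> n z x\<bar> \<le> \<delta>"
proof -
  have "\<exists>!c. schauder_expansion S \<psi> z c"
    using assms by (auto simp: schauder_basis_def cont_space_def)
  then have "schauder_expansion S \<psi> z (THE c. schauder_expansion S \<psi> z c)"
    by (rule theI')
  then have "(\<lambda>n. sup_norm S (\<lambda>x. z x - schauder_proj S \<psi> n z x)) \<longlonglongrightarrow> 0"
    by (simp add: schauder_expansion_def schauder_proj_def)
  from order_tendstoD(2)[OF this \<open>\<delta> > 0\<close>]
  show ?thesis
  proof eventually_elim
    case (elim n)
    show ?case
    proof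
      fix x assume "x \<in> S"
      have "continuous_on S (\<lambda>x. z x - schauder_proj S \<psi> n z x)"
        by (intro continuous_intros assms(3) continuous_on_schauder_proj assms(2))
      from abs_le_sup_norm[OF assms(1) this \<open>x \<in> S\<close>] elim
      show "\<bar>z x - schauder_proj S \<psi> n z x\<bar> \<le> \<delta>" by linarith
    qed
  qed
qed

section \<open>Integrals with a variable upper bound\<close>

lemma integral_affine_unit_interval:
  fixes f :: "real \<Rightarrow> real"
  assumes "c \<le> d" "continuous_on {c..d} f"
  shows "integral {c..d} f = (d - c) * integral {0..1} (\<lambda>\<tau>. f (c + \<tau> * (d - c)))"
\<comment> \<open>The rescaling needs \<open>d - c > 0\<close>; for \<open>c = d\<close> both sides
  are 0.\<close>
proof (cases "c = d")
  case False
  then have d: "d - c > 0" using assms by simp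
  have "f integrable_on {c..d}" using assms integrable_continuous_real by blast
  then have "(f has_integral integral {c..d} f) (cbox c d)" by (simp add: integrable_integral)
  from has_integral_affinity'[OF this d, of c]
  have "((\<lambda>\<tau>. f (c + \<tau> * (d - c))) has_integral integral {c..d} f / (d - c)) {0..1}"
    using d by (simp add: divide_inverse mult.commute add.commute)
  then show ?thesis using d by (simp add: integral_unique)
qed auto

text \<open>Substituting \<open>y = c + \<tau> * (h p - c)\<close> moves the dependence on
  \<open>p\<close> from the domain into the integrand. Over the fixed interval [0,1] the continuity
  of parametric integrals applies.\<close>

lemma continuous_on_integral_upper_bound:
  fixes f :: "'a::topological_space \<times> real \<Rightarrow> real"
  assumes f: "continuous_on (S \<times> {c..d}) f"
    and h: "continuous_on S h" "\<And>p. p \<in> S \<Longrightarrow> h p \<in> {c..d}"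
  shows "continuous_on S (\<lambda>p. integral {c..h p} (\<lambda>y. f (p, y)))"
proof -
  have "c + \<tau> * (h p - c) \<in> {c..d}" if "p \<in> S" "\<tau> \<in> {0..1}" for p \<tau>
  proof -
    have "\<tau> * (h p - c) \<le> 1 * (h p - c)"
      using that h(2) by (intro mult_right_mono) auto
    moreover have "0 \<le> \<tau> * (h p - c)"
      using that h(2) by auto
    ultimately show ?thesis using h(2)[OF that(1)] by auto
  qed
  then have "continuous_on (S \<times> {0..1}) (\<lambda>q. f (fst q, c + snd q * (h (fst q) - c)))"
    by (intro continuous_on_compose2[OF f] continuous_intros continuous_on_compose2[OF h(1)]) auto
  then have "continuous_on (S \<times> cbox 0 1) (\<lambda>(p, \<tau>). f (p, c + \<tau> * (h p - c)))"
    by (simp add: case_prod_unfold)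
  from integral_continuous_on_param[OF this]
  have "continuous_on S (\<lambda>p. (h p - c) * integral {0..1} (\<lambda>\<tau>. f (p, c + \<tau> * (h p - c))))"
    by (intro continuous_intros h(1)) simp
  moreover have "integral {c..h p} (\<lambda>y. f (p, y)) =
      (h p - c) * integral {0..1} (\<lambda>\<tau>. f (p, c + \<tau> * (h p - c)))" if "p \<in> S" for p
  proof (rule integral_affine_unit_interval)
    show "c \<le> h p" using h(2)[OF that] by simp
    show "continuous_on {c..h p} (\<lambda>y. f (p, y))"
      using that h(2)[OF that] by (intro continuous_on_compose2[OF f] continuous_intros) auto
  qed
  ultimately show ?thesis by (simp cong: continuous_on_cong)
qed

lemma abs_integral_le_exp:
  fixes f :: "real \<Rightarrow> real"
  assumes "f integrable_on {0..t}" "\<And>r. r \<in> {0..t} \<Longrightarrow> \<bar>f r\<bar> \<le> C * exp (\<Lambda> * r)"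
    "\<Lambda> > 0" "C \<ge> 0" "t \<ge> 0"
  shows "\<bar>integral {0..t} f\<bar> \<le> C / \<Lambda> * exp (\<Lambda> * t)"
proof -
  have "((\<lambda>r. C * exp (\<Lambda> * r)) has_integral
      (C / \<Lambda> * exp (\<Lambda> * t) - C / \<Lambda> * exp (\<Lambda> * 0))) {0..t}"
    using assms(3,5)
    by (intro fundamental_theorem_of_calculus)
       (auto intro!: derivative_eq_intros simp flip: has_real_derivative_iff_has_vector_derivative)
  then have "norm (integral {0..t} f) \<le> C / \<Lambda> * exp (\<Lambda> * t) - C / \<Lambda> * exp (\<Lambda> * 0)"
    using integral_norm_bound_integral[OF assms(1) has_integral_integrable] assms(2)
    by (metis integral_unique real_norm_def)
  moreover have "0 \<le> C / \<Lambda>" using assms by simp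
  ultimately show ?thesis by simp
qed

section \<open>Continuity and integrability of the iterated integrals\<close>

context
  fixes \<alpha> \<beta> T :: real
begin

abbreviation (input) "\<Omega> \<equiv> Omega \<alpha> \<beta> T"

lemma mem_Omega: "(x, t) \<in> \<Omega> \<longleftrightarrow> \<alpha> \<le> x \<and> x \<le> \<alpha> + \<beta> \<and> 0 \<le> t \<and> t \<le> T"
  by (auto simp: Omega_def)

lemma compact_Omega: "compact \<Omega>"
  by (auto simp: Omega_def intro: compact_Times)

text \<open>Joint continuity in \<open>z\<close> and \<open>s\<close> is what the next integration,
  over \<open>s\<close> with parameter \<open>z\<close>, requires of its integrand.\<close>

lemma continuous_on_integral_y:
  fixes F :: "(real \<times> real) \<times> (real \<times> real) \<Rightarrow> real"
  assumes F: "continuous_on (\<Omega> \<times> \<Omega>) F"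
  shows "continuous_on (\<Omega> \<times> {0..T}) (\<lambda>(z, s). integral {\<alpha>..fst z} (\<lambda>y. F (z, (y, s))))"
proof -
  have "continuous_on ((\<Omega> \<times> {0..T}) \<times> {\<alpha>..\<alpha> + \<beta>}) (\<lambda>q. F (fst (fst q), (snd q, snd (fst q))))"
    by (intro continuous_on_compose2[OF F] continuous_intros) (auto simp: mem_Omega)
  \<comment> \<open>The unreduced projections of \<open>(p, y)\<close> keep the integrand in the
    shape \<open>f (p, y)\<close>, which the rule has to unify with.\<close>
  then have "continuous_on (\<Omega> \<times> {0..T}) (\<lambda>p. integral {\<alpha>..fst (fst p)}
      (\<lambda>y. F (fst (fst (p, y)), (snd (p, y), snd (fst (p, y))))))"
    by (rule continuous_on_integral_upper_bound) (auto intro!: continuous_intros simp: mem_Omega)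
  then show ?thesis by (simp add: case_prod_unfold)
qed

lemma continuous_on_integral_s_y:
  fixes F :: "(real \<times> real) \<times> (real \<times> real) \<Rightarrow> real"
  assumes F: "continuous_on (\<Omega> \<times> \<Omega>) F"
  shows "continuous_on \<Omega> (\<lambda>(x, r). integral {0..r} (\<lambda>s. integral {\<alpha>..x} (\<lambda>y. F ((x, r), (y, s)))))"
proof -
  have "continuous_on \<Omega> (\<lambda>z. integral {0..snd z}
      (\<lambda>s. (\<lambda>(z, s). integral {\<alpha>..fst z} (\<lambda>y. F (z, (y, s)))) (z, s)))"
    by (rule continuous_on_integral_upper_bound[OF continuous_on_integral_y[OF F]])
       (auto intro!: continuous_intros simp: mem_Omega)
  then show ?thesis by (simp add: case_prod_unfold)
qed

lemma continuous_on_integral_r: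
  fixes f :: "real \<times> real \<Rightarrow> real"
  assumes f: "continuous_on \<Omega> f"
  shows "continuous_on \<Omega> (\<lambda>(x, t). integral {0..t} (\<lambda>r. f (x, r)))"
proof -
  have "continuous_on (\<Omega> \<times> {0..T}) (\<lambda>q. f (fst (fst q), snd q))"
    by (intro continuous_on_compose2[OF f] continuous_intros) (auto simp: mem_Omega)
  then have "continuous_on \<Omega> (\<lambda>z. integral {0..snd z} (\<lambda>r. f (fst (fst (z, r)), snd (z, r))))"
    by (rule continuous_on_integral_upper_bound) (auto intro!: continuous_intros simp: mem_Omega)
  then show ?thesis by (simp add: case_prod_unfold)
qed

lemma integrable_r:
  fixes f :: "real \<times> real \<Rightarrow> real"
  assumes "continuous_on \<Omega> f" "(x, t) \<in> \<Omega>"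
  shows "(\<lambda>r. f (x, r)) integrable_on {0..t}"
  using assms(2)
  by (intro integrable_continuous_real continuous_on_compose2[OF assms(1)] continuous_intros)
     (auto simp: mem_Omega)

lemma integrable_y:
  fixes F :: "(real \<times> real) \<times> (real \<times> real) \<Rightarrow> real"
  assumes "continuous_on (\<Omega> \<times> \<Omega>) F" "(x, t) \<in> \<Omega>" "s \<in> {0..T}"
  shows "(\<lambda>y. F ((x, t), (y, s))) integrable_on {\<alpha>..x}"
  using assms(2,3)
  by (intro integrable_continuous_real continuous_on_compose2[OF assms(1)] continuous_intros)
     (auto simp: mem_Omega)

lemma integrable_s:
  fixes F :: "(real \<times> real) \<times> (real \<times> real) \<Rightarrow> real"
  assumes F: "continuous_on (\<Omega> \<times> \<Omega>) F" and "(x, t) \<in> \<Omega>"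
  shows "(\<lambda>s. integral {\<alpha>..x} (\<lambda>y. F ((x, t), (y, s)))) integrable_on {0..t}"
proof -
  have "continuous_on {0..t}
      (\<lambda>s. (\<lambda>(z, s). integral {\<alpha>..fst z} (\<lambda>y. F (z, (y, s)))) ((x, t), s))"
    using assms(2)
    by (intro continuous_on_compose2[OF continuous_on_integral_y[OF F]] continuous_intros)
       (auto simp: mem_Omega)
  then show ?thesis by (auto intro: integrable_continuous_real)
qed

lemma integrable_r_s_y:
  fixes F :: "(real \<times> real) \<times> (real \<times> real) \<Rightarrow> real"
  assumes "continuous_on (\<Omega> \<times> \<Omega>) F" "(x, t) \<in> \<Omega>"
  shows "(\<lambda>r. integral {0..r} (\<lambda>s. integral {\<alpha>..x} (\<lambda>y. F ((x, r), (y, s))))) integrable_on {0..t}"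
  using integrable_r[OF continuous_on_integral_s_y[OF assms(1)] assms(2)] by simp

section \<open>The Volterra operator and its dependence on the integrands\<close>

text \<open>The integrands \<open>\<phi>\<close> and \<open>F\<close> are left free so that the
  integrated equation (\<open>\<phi> = a * u\<close>, \<open>F = L0 K u\<close>) and the operators
  \<open>G_op\<close> (their projected versions) are both instances and can be compared by one
  estimate.\<close>

definition volterra ::
    "(real \<times> real \<Rightarrow> real) \<Rightarrow> (real \<Rightarrow> real) \<Rightarrow> (real \<times> real \<Rightarrow> real) \<Rightarrow>
     ((real \<times> real) \<times> (real \<times> real) \<Rightarrow> real) \<Rightarrow> real \<times> real \<Rightarrow> real" where
  "volterra g u0 \<phi> F = (\<lambda>(x, t). u0 x + integral {0..t} (\<lambda>r. \<phi> (x, r))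
     + integral {0..t} (\<lambda>r. g (x, r))
     + integral {0..t} (\<lambda>r. integral {0..r} (\<lambda>s. integral {\<alpha>..x} (\<lambda>y. F ((x, r), (y, s))))))"

lemma continuous_on_volterra:
  assumes "continuous_on \<Omega> g" "continuous_on {\<alpha>..\<alpha> + \<beta>} u0"
    "continuous_on \<Omega> \<phi>" "continuous_on (\<Omega> \<times> \<Omega>) F"
  shows "continuous_on \<Omega> (volterra g u0 \<phi> F)"
proof -
  have "continuous_on \<Omega> (\<lambda>z. u0 (fst z))"
    by (intro continuous_on_compose2[OF assms(2)] continuous_intros) (auto simp: mem_Omega)
  from continuous_on_add[OF continuous_on_add[OF continuous_on_add[OF this
        continuous_on_integral_r[OF assms(3)]] continuous_on_integral_r[OF assms(1)]]
        continuous_on_integral_r[OF continuous_on_integral_s_y[OF assms(4)]]]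
  show ?thesis by (simp add: volterra_def case_prod_unfold)
qed

text \<open>The terms with \<open>u0\<close> and \<open>g\<close> cancel and the rest is linear.
  Since the integral is additive only on integrable functions, the triple integral is split from the
  inside out, with integrability from continuity at each level.\<close>

lemma volterra_diff:
  assumes \<phi>: "continuous_on \<Omega> \<phi>1" "continuous_on \<Omega> \<phi>2"
    and F: "continuous_on (\<Omega> \<times> \<Omega>) F1" "continuous_on (\<Omega> \<times> \<Omega>) F2"
    and xt: "(x, t) \<in> \<Omega>"
  shows "volterra g u0 \<phi>1 F1 (x, t) - volterra g u0 \<phi>2 F2 (x, t) =
    integral {0..t} (\<lambda>r. \<phi>1 (x, r) - \<phi>2 (x, r)) +
    integral {0..t} (\<lambda>r. integral {0..r} (\<lambda>s. integral {\<alpha>..x}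
      (\<lambda>y. F1 ((x, r), (y, s)) - F2 ((x, r), (y, s)))))"
proof -
  have r: "(x, r) \<in> \<Omega>" if "r \<in> {0..t}" for r using that xt by (auto simp: mem_Omega)
  have "integral {0..t} (\<lambda>r. integral {0..r} (\<lambda>s. integral {\<alpha>..x}
      (\<lambda>y. F1 ((x, r), (y, s)) - F2 ((x, r), (y, s))))) =
    integral {0..t} (\<lambda>r. integral {0..r} (\<lambda>s. integral {\<alpha>..x} (\<lambda>y. F1 ((x, r), (y, s)))) -
      integral {0..r} (\<lambda>s. integral {\<alpha>..x} (\<lambda>y. F2 ((x, r), (y, s)))))"
  proof (rule integral_cong)
    fix r assume "r \<in> {0..t}"
    note r = r[OF this]
    have "integral {0..r} (\<lambda>s. integral {\<alpha>..x} (\<lambda>y. F1 ((x, r), (y, s)) - F2 ((x, r), (y, s)))) =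
      integral {0..r} (\<lambda>s. integral {\<alpha>..x} (\<lambda>y. F1 ((x, r), (y, s))) -
        integral {\<alpha>..x} (\<lambda>y. F2 ((x, r), (y, s))))"
      using r
      by (intro integral_cong Henstock_Kurzweil_Integration.integral_diff integrable_y F)
         (auto simp: mem_Omega)
    also have "\<dots> = integral {0..r} (\<lambda>s. integral {\<alpha>..x} (\<lambda>y. F1 ((x, r), (y, s)))) -
      integral {0..r} (\<lambda>s. integral {\<alpha>..x} (\<lambda>y. F2 ((x, r), (y, s))))"
      by (intro Henstock_Kurzweil_Integration.integral_diff integrable_s F r)
    finally show "integral {0..r} (\<lambda>s. integral {\<alpha>..x}
        (\<lambda>y. F1 ((x, r), (y, s)) - F2 ((x, r), (y, s)))) = \<dots>" .
  qed
  also have "\<dots> =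
      integral {0..t} (\<lambda>r. integral {0..r} (\<lambda>s. integral {\<alpha>..x} (\<lambda>y. F1 ((x, r), (y, s))))) -
      integral {0..t} (\<lambda>r. integral {0..r} (\<lambda>s. integral {\<alpha>..x} (\<lambda>y. F2 ((x, r), (y, s)))))"
    by (intro Henstock_Kurzweil_Integration.integral_diff integrable_r_s_y F xt)
  finally show ?thesis
    using Henstock_Kurzweil_Integration.integral_diff
      [OF integrable_r[OF \<phi>(1) xt] integrable_r[OF \<phi>(2) xt]]
    by (simp add: volterra_def)
qed

text \<open>The integral over \<open>y\<close> costs the length of its interval, at most
  \<open>\<beta>\<close>, and each integral over time gains \<open>1 / \<Lambda>\<close>.\<close>

lemma volterra_weighted_bound:
  assumes beta_nonneg: "\<beta> \<ge> 0"
    and \<phi>: "continuous_on \<Omega> \<phi>1" "continuous_on \<Omega> \<phi>2"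
    and F: "continuous_on (\<Omega> \<times> \<Omega>) F1" "continuous_on (\<Omega> \<times> \<Omega>) F2"
    and d\<phi>: "\<And>x r. (x, r) \<in> \<Omega> \<Longrightarrow> \<bar>\<phi>1 (x, r) - \<phi>2 (x, r)\<bar> \<le> C1 * exp (\<Lambda> * r)"
    and dF: "\<And>z y s. z \<in> \<Omega> \<Longrightarrow> (y, s) \<in> \<Omega> \<Longrightarrow> \<bar>F1 (z, (y, s)) - F2 (z, (y, s))\<bar> \<le> C2 * exp (\<Lambda> * s)"
    and C: "C1 \<ge> 0" "C2 \<ge> 0" and \<Lambda>: "\<Lambda> \<ge> 1"
    and xt: "(x, t) \<in> \<Omega>"
  shows "\<bar>volterra g u0 \<phi>1 F1 (x, t) - volterra g u0 \<phi>2 F2 (x, t)\<bar> \<le> (C1 + \<beta> * C2) / \<Lambda> * exp (\<Lambda> * t)"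
proof -
  have r: "(x, r) \<in> \<Omega>" if "r \<in> {0..t}" for r using that xt by (auto simp: mem_Omega)
  define F where "F = (\<lambda>z. F1 z - F2 z)"
  have F_cont: "continuous_on (\<Omega> \<times> \<Omega>) F"
    unfolding F_def by (intro continuous_intros F)
  have t0: "t \<ge> 0" using xt by (simp add: mem_Omega)
  have inner: "\<bar>integral {\<alpha>..x} (\<lambda>y. F ((x, r), (y, s)))\<bar> \<le> \<beta> * C2 * exp (\<Lambda> * s)"
    if "r \<in> {0..t}" "s \<in> {0..r}" for r s
  proof -
    have s: "s \<in> {0..T}" using that r[OF that(1)] by (auto simp: mem_Omega)
    have "norm (integral {\<alpha>..x} (\<lambda>y. F ((x, r), (y, s)))) \<le> integral {\<alpha>..x} (\<lambda>y. C2 * exp (\<Lambda> * s))"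
      using s r[OF that(1)]
      by (intro integral_norm_bound_integral integrable_y F_cont) (auto simp: F_def mem_Omega intro!: dF)
    also have "\<dots> = (x - \<alpha>) * (C2 * exp (\<Lambda> * s))"
      using xt by (simp add: mem_Omega)
    also have "\<dots> \<le> \<beta> * (C2 * exp (\<Lambda> * s))"
      using xt C by (intro mult_right_mono) (auto simp: mem_Omega)
    finally show ?thesis by (simp add: mult.assoc)
  qed
  have middle: "\<bar>integral {0..r} (\<lambda>s. integral {\<alpha>..x} (\<lambda>y. F ((x, r), (y, s))))\<bar>
      \<le> \<beta> * C2 / \<Lambda> * exp (\<Lambda> * r)" if "r \<in> {0..t}" for r
    using inner[OF that] \<Lambda> C beta_nonneg that
    by (intro abs_integral_le_exp integrable_s F_cont r) auto
  \<comment> \<open>The triple integral contains two time integrations. One of the two gains is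
    given up, using \<open>\<Lambda> \<ge> 1\<close>, so that both terms have the same denominator
    \<open>\<Lambda>\<close>.\<close>
  have le: "\<beta> * C2 / \<Lambda> \<le> \<beta> * C2"
    using \<Lambda> mult_nonneg_nonneg[OF beta_nonneg C(2)] by (simp add: divide_le_eq mult_le_cancel_left1)
  have "\<bar>integral {0..t} (\<lambda>r. integral {0..r} (\<lambda>s. integral {\<alpha>..x} (\<lambda>y. F ((x, r), (y, s)))))\<bar>
      \<le> \<beta> * C2 / \<Lambda> * exp (\<Lambda> * t)"
    using \<Lambda> C beta_nonneg t0
    by (intro abs_integral_le_exp integrable_r_s_y F_cont xt order_trans[OF middle]
        mult_right_mono[OF le]) auto
  moreover have "\<bar>integral {0..t} (\<lambda>r. \<phi>1 (x, r) - \<phi>2 (x, r))\<bar> \<le> C1 / \<Lambda> * exp (\<Lambda> * t)"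
    using \<Lambda> C t0
    by (intro abs_integral_le_exp Henstock_Kurzweil_Integration.integrable_diff integrable_r \<phi> xt d\<phi> r) auto
  ultimately show ?thesis
    unfolding volterra_diff[OF \<phi> assms(4,5) xt]
    by (simp add: F_def add_divide_distrib distrib_right)
qed

section \<open>The solution as a fixed point, and one approximate step\<close>

lemma G_op_eq_volterra:
  "G_op \<alpha> \<beta> T a g u0 K A B n v = volterra g u0
     (schauder_proj \<Omega> A (n ^ 2) (\<lambda>z. a z * v z)) (schauder_proj (\<Omega> \<times> \<Omega>) B (n ^ 4) (L0 K v))"
  by (simp add: G_op_def volterra_def)

lemma continuous_on_L0:
  assumes K: "continuous_on ((\<Omega> \<times> \<Omega>) \<times> UNIV) K" and v: "continuous_on \<Omega> v"
  shows "continuous_on (\<Omega> \<times> \<Omega>) (L0 K v)"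
proof -
  have "continuous_on (\<Omega> \<times> \<Omega>) (\<lambda>q. K (q, v (snd q)))"
    by (intro continuous_on_compose2[OF K] continuous_intros continuous_on_compose2[OF v]) auto
  then show ?thesis by (simp add: L0_def case_prod_unfold)
qed

text \<open>The differential equation is integrated in time from 0 to \<open>t\<close>; the initial
  condition supplies \<open>u0 x\<close>.\<close>

lemma solution_eq_volterra:
  assumes a: "continuous_on \<Omega> a" and g: "continuous_on \<Omega> g"
    and K: "continuous_on ((\<Omega> \<times> \<Omega>) \<times> UNIV) K"
    and sol: "is_solution \<alpha> \<beta> T a g u0 K u" and xt: "(x, t) \<in> \<Omega>"
  shows "u (x, t) = volterra g u0 (\<lambda>z. a z * u z) (L0 K u) (x, t)"
proof -
  have u: "continuous_on \<Omega> u"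
    using sol by (simp add: is_solution_def cont_space_def)
  obtain ut where
    der: "\<And>x t. (x, t) \<in> \<Omega> \<Longrightarrow> ((\<lambda>\<tau>. u (x, \<tau>)) has_real_derivative ut (x, t)) (at t within {0..T})"
    and ut: "\<And>x t. (x, t) \<in> \<Omega> \<Longrightarrow> ut (x, t) = a (x, t) * u (x, t) + g (x, t) +
      integral {0..t} (\<lambda>s. integral {\<alpha>..x} (\<lambda>y. L0 K u ((x, t), (y, s))))"
    using sol unfolding is_solution_def L0_def by fastforce
  have r: "(x, r) \<in> \<Omega>" if "r \<in> {0..t}" for r using that xt by (auto simp: mem_Omega)
  have "((\<lambda>r. ut (x, r)) has_integral (u (x, t) - u (x, 0))) {0..t}"
  proof (rule fundamental_theorem_of_calculus)
    show "0 \<le> t" using xt by (simp add: mem_Omega)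
    fix r assume "r \<in> {0..t}"
    from has_field_derivative_subset[OF der[OF r[OF this]]]
    show "((\<lambda>r. u (x, r)) has_vector_derivative ut (x, r)) (at r within {0..t})"
      using xt unfolding has_real_derivative_iff_has_vector_derivative by (auto simp: mem_Omega)
  qed
  then have "u (x, t) - u (x, 0) = integral {0..t} (\<lambda>r. ut (x, r))"
    by (simp add: integral_unique)
  also have "\<dots> = integral {0..t} (\<lambda>r. a (x, r) * u (x, r) + g (x, r) +
      integral {0..r} (\<lambda>s. integral {\<alpha>..x} (\<lambda>y. L0 K u ((x, r), (y, s)))))"
    by (intro integral_cong ut r)
  also have "\<dots> = integral {0..t} (\<lambda>r. a (x, r) * u (x, r)) + integral {0..t} (\<lambda>r. g (x, r)) +
      integral {0..t} (\<lambda>r. integral {0..r} (\<lambda>s. integral {\<alpha>..x} (\<lambda>y. L0 K u ((x, r), (y, s)))))"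
  proof -
    have au: "(\<lambda>r. a (x, r) * u (x, r)) integrable_on {0..t}"
      using integrable_r[OF continuous_on_mult[OF a u] xt] .
    show ?thesis
      by (simp add: Henstock_Kurzweil_Integration.integral_add
          Henstock_Kurzweil_Integration.integrable_add au integrable_r[OF g xt]
          integrable_r_s_y[OF continuous_on_L0[OF K u] xt])
  qed
  finally show ?thesis
    using sol xt by (simp add: volterra_def is_solution_def mem_Omega)
qed

text \<open>\<open>D\<close> bounds the error of \<open>v\<close> in the weighted norm. The choice
  of \<open>\<Lambda>\<close> makes the Lipschitz part of the new error at most
  \<open>D / 2\<close>, and a large \<open>n\<close>, chosen for this particular \<open>v\<close>,
  makes the projection part at most \<open>\<eta>\<close>. Continuity of the new iterate is included
  so that the step can be repeated.\<close>

lemma ex_G_op_halving_error: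
  assumes beta_nonneg: "\<beta> \<ge> 0"
    and a: "continuous_on \<Omega> a" and g: "continuous_on \<Omega> g"
    and u0: "continuous_on {\<alpha>..\<alpha> + \<beta>} u0"
    and K: "continuous_on ((\<Omega> \<times> \<Omega>) \<times> UNIV) K"
    and lip: "\<And>q w1 w2. q \<in> \<Omega> \<times> \<Omega> \<Longrightarrow> \<bar>K (q, w1) - K (q, w2)\<bar> \<le> M * \<bar>w1 - w2\<bar>"
    and A: "schauder_basis \<Omega> A" and B: "schauder_basis (\<Omega> \<times> \<Omega>) B"
    and sol: "is_solution \<alpha> \<beta> T a g u0 K u"
    and M: "M \<ge> 0" and N: "N \<ge> 0" "\<And>z. z \<in> \<Omega> \<Longrightarrow> \<bar>a z\<bar> \<le> N"
    and \<Lambda>: "\<Lambda> \<ge> 1" "\<Lambda> \<ge> 2 * (N + \<beta> * M)"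
    and v: "continuous_on \<Omega> v" and D: "D \<ge> 0"
    and uv: "\<And>x t. (x, t) \<in> \<Omega> \<Longrightarrow> \<bar>u (x, t) - v (x, t)\<bar> \<le> D * exp (\<Lambda> * t)"
    and \<eta>: "\<eta> > 0"
  shows "\<exists>n\<ge>1. continuous_on \<Omega> (G_op \<alpha> \<beta> T a g u0 K A B n v) \<and>
    (\<forall>x t. (x, t) \<in> \<Omega> \<longrightarrow>
       \<bar>u (x, t) - G_op \<alpha> \<beta> T a g u0 K A B n v (x, t)\<bar> \<le> (D / 2 + \<eta>) * exp (\<Lambda> * t))"
proof -
  \<comment> \<open>The error of the projection of \<open>a * v\<close> enters with factor 1, that
    of \<open>L0 K v\<close> with factor \<open>\<beta>\<close>; together they contribute
    \<open>\<delta> * (1 + \<beta>) = \<eta>\<close>.\<close>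
  define \<delta> where "\<delta> = \<eta> / (1 + \<beta>)"
  have \<delta>: "\<delta> > 0" "\<delta> * (1 + \<beta>) = \<eta>" using \<eta> beta_nonneg by (auto simp: \<delta>_def)
  have u: "continuous_on \<Omega> u" using sol by (simp add: is_solution_def cont_space_def)
  note av = continuous_on_mult[OF a v] and au = continuous_on_mult[OF a u]
  note Lv = continuous_on_L0[OF K v] and Lu = continuous_on_L0[OF K u]
  \<comment> \<open>The indices \<open>n ^ 2\<close> and \<open>n ^ 4\<close> tend to infinity with
    \<open>n\<close>, so both approximations hold eventually in \<open>n\<close> and one
    \<open>n \<ge> 1\<close> serves both.\<close>
  have "filterlim (\<lambda>n::nat. n ^ 2) sequentially sequentially"
    "filterlim (\<lambda>n::nat. n ^ 4) sequentially sequentially"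
    by (auto intro!: filterlim_subseq simp: strict_mono_def power_strict_mono)
  then have "\<forall>\<^sub>F n in sequentially. \<forall>z\<in>\<Omega>. \<bar>a z * v z - schauder_proj \<Omega> A (n ^ 2) (\<lambda>z. a z * v z) z\<bar> \<le> \<delta>"
    "\<forall>\<^sub>F n in sequentially. \<forall>q\<in>\<Omega> \<times> \<Omega>. \<bar>L0 K v q - schauder_proj (\<Omega> \<times> \<Omega>) B (n ^ 4) (L0 K v) q\<bar> \<le> \<delta>"
    using eventually_compose_filterlim
      [OF schauder_proj_approx[OF compact_Omega A av \<delta>(1)]]
      eventually_compose_filterlim
      [OF schauder_proj_approx[OF compact_Times[OF compact_Omega compact_Omega] B Lv \<delta>(1)]]
    by blast+
  from eventually_happens'[OF sequentially_bot
      eventually_conj[OF eventually_ge_at_top[of 1] eventually_conj[OF this]]]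
  obtain n where n: "n \<ge> 1"
    and P: "\<And>z. z \<in> \<Omega> \<Longrightarrow> \<bar>a z * v z - schauder_proj \<Omega> A (n ^ 2) (\<lambda>z. a z * v z) z\<bar> \<le> \<delta>"
    and R: "\<And>q. q \<in> \<Omega> \<times> \<Omega> \<Longrightarrow> \<bar>L0 K v q - schauder_proj (\<Omega> \<times> \<Omega>) B (n ^ 4) (L0 K v) q\<bar> \<le> \<delta>"
    by blast
  note proj = continuous_on_schauder_proj[OF A] continuous_on_schauder_proj[OF B]
  \<comment> \<open>A uniform error is also a weighted one, as the weight is at least 1.\<close>
  have \<delta>_le: "\<delta> \<le> \<delta> * exp (\<Lambda> * t)" if "t \<ge> 0" for t
    using that \<delta>(1) \<Lambda>(1) by (simp add: mult_le_cancel_left1)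
  show ?thesis
  proof (intro exI[of _ n] conjI allI impI)
    show "n \<ge> 1" by (fact n)
    show "continuous_on \<Omega> (G_op \<alpha> \<beta> T a g u0 K A B n v)"
      unfolding G_op_eq_volterra by (intro continuous_on_volterra g u0 proj)
    fix x t assume xt: "(x, t) \<in> \<Omega>"
    \<comment> \<open>Both pairs of integrands are compared by the triangle inequality through the
      unprojected \<open>a * v\<close> and \<open>L0 K v\<close>. This gives
      \<open>C1 = N * D + \<delta>\<close> and \<open>C2 = M * D + \<delta>\<close>.\<close>
    have "\<bar>u (x, t) - G_op \<alpha> \<beta> T a g u0 K A B n v (x, t)\<bar>
        \<le> ((N * D + \<delta>) + \<beta> * (M * D + \<delta>)) / \<Lambda> * exp (\<Lambda> * t)"
      unfolding G_op_eq_volterra solution_eq_volterra[OF a g K sol xt]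
    proof (rule volterra_weighted_bound[OF beta_nonneg au proj(1) Lu proj(2)])
      fix x r assume xr: "(x, r) \<in> \<Omega>"
      have "\<bar>a (x, r) * u (x, r) - a (x, r) * v (x, r)\<bar> \<le> N * (D * exp (\<Lambda> * r))"
        unfolding right_diff_distrib[symmetric] abs_mult
        using N uv[OF xr] xr by (intro mult_mono) auto
      with P[OF xr] \<delta>_le[of r] xr
      show "\<bar>a (x, r) * u (x, r) - schauder_proj \<Omega> A (n ^ 2) (\<lambda>z. a z * v z) (x, r)\<bar>
          \<le> (N * D + \<delta>) * exp (\<Lambda> * r)"
        by (simp add: mem_Omega distrib_right mult.assoc)
    next
      fix z y s assume z: "z \<in> \<Omega>" and ys: "(y, s) \<in> \<Omega>"
      have "\<bar>L0 K u (z, (y, s)) - L0 K v (z, (y, s))\<bar> \<le> M * \<bar>u (y, s) - v (y, s)\<bar>"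
        using lip[of "(z, (y, s))"] z ys by (simp add: L0_def case_prod_unfold)
      also have "\<dots> \<le> M * (D * exp (\<Lambda> * s))"
        using M uv[OF ys] by (rule mult_left_mono[rotated])
      finally show "\<bar>L0 K u (z, (y, s)) - schauder_proj (\<Omega> \<times> \<Omega>) B (n ^ 4) (L0 K v) (z, (y, s))\<bar>
          \<le> (M * D + \<delta>) * exp (\<Lambda> * s)"
        using R[of "(z, (y, s))"] z ys \<delta>_le[of s]
        by (simp add: mem_Omega distrib_right mult.assoc)
    qed (use N M D \<delta> \<Lambda> xt in auto)
    also have "\<dots> \<le> (D / 2 + \<eta>) * exp (\<Lambda> * t)"
    proof (rule mult_right_mono)
      have "(N * D + \<delta>) + \<beta> * (M * D + \<delta>) = (N + \<beta> * M) * D + \<eta>"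
        using \<delta>(2) by (simp add: algebra_simps)
      also have "\<dots> \<le> (\<Lambda> / 2) * D + \<Lambda> * \<eta>"
        using \<Lambda> D \<eta> by (intro add_mono mult_right_mono) (auto simp: mult_le_cancel_right1)
      finally show "((N * D + \<delta>) + \<beta> * (M * D + \<delta>)) / \<Lambda> \<le> D / 2 + \<eta>"
        using \<Lambda>(1) by (simp add: divide_le_eq algebra_simps)
    qed simp
    finally show "\<bar>u (x, t) - G_op \<alpha> \<beta> T a g u0 K A B n v (x, t)\<bar> \<le> (D / 2 + \<eta>) * exp (\<Lambda> * t)" .
  qed
qed

end

section \<open>Iteration of the step and choice of the constants\<close>

theorem theorem4:
  fixes \<alpha> \<beta> T M :: real
    and a g u :: "real \<times> real \<Rightarrow> real"
    and u0 :: "real \<Rightarrow> real"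
    and K :: "((real \<times> real) \<times> (real \<times> real)) \<times> real \<Rightarrow> real"
    and A :: "nat \<Rightarrow> real \<times> real \<Rightarrow> real"
    and B :: "nat \<Rightarrow> (real \<times> real) \<times> (real \<times> real) \<Rightarrow> real"
  assumes "\<beta> > 0" and "T > 0"
    and "a \<in> cont_space (Omega \<alpha> \<beta> T)"
    and "g \<in> cont_space (Omega \<alpha> \<beta> T)"
    and "u0 \<in> cont_space {\<alpha>..\<alpha> + \<beta>}"
    and "K \<in> cont_space ((Omega \<alpha> \<beta> T \<times> Omega \<alpha> \<beta> T) \<times> UNIV)"
    and "\<And>q w1 w2. q \<in> Omega \<alpha> \<beta> T \<times> Omega \<alpha> \<beta> T \<Longrightarrow>
           \<bar>K (q, w1) - K (q, w2)\<bar> \<le> M * \<bar>w1 - w2\<bar>"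
    and "schauder_basis (Omega \<alpha> \<beta> T) A"
    and "schauder_basis (Omega \<alpha> \<beta> T \<times> Omega \<alpha> \<beta> T) B"
    and "is_solution \<alpha> \<beta> T a g u0 K u"
  shows "\<forall>\<epsilon>>0. \<forall>v\<in>cont_space (Omega \<alpha> \<beta> T). \<exists>m\<ge>1. \<exists>n :: nat \<Rightarrow> nat.
           (\<forall>p\<in>{1..m}. n p \<ge> 1) \<and>
           sup_norm (Omega \<alpha> \<beta> T)
             (\<lambda>z. u z - fold (\<lambda>p. G_op \<alpha> \<beta> T a g u0 K A B (n p)) [1..<Suc m] v z) < \<epsilon>"
proof (intro allI impI ballI)
  fix \<epsilon> :: real and v assume \<epsilon>: "\<epsilon> > 0" and v: "v \<in> cont_space (Omega \<alpha> \<beta> T)"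
  let ?\<Omega> = "Omega \<alpha> \<beta> T"
  let ?G = "G_op \<alpha> \<beta> T a g u0 K A B"
  have \<beta>: "\<beta> \<ge> 0" using \<open>\<beta> > 0\<close> by simp
  note compact = compact_Omega
  have v: "continuous_on ?\<Omega> v" and u: "continuous_on ?\<Omega> u" and a: "continuous_on ?\<Omega> a"
    and g: "continuous_on ?\<Omega> g" and u0: "continuous_on {\<alpha>..\<alpha> + \<beta>} u0"
    and K: "continuous_on ((?\<Omega> \<times> ?\<Omega>) \<times> UNIV) K"
    using v assms(3-6,10) by (auto simp: cont_space_def is_solution_def)
  \<comment> \<open>This corner is the test point for the signs of \<open>M\<close>,
    \<open>N\<close> and \<open>D\<close>, and it makes the final supremum one over a nonempty
    set.\<close>
  have ne: "(\<alpha>, 0) \<in> ?\<Omega>" using assms(1,2) by (simp add: Omega_def)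
  have M: "M \<ge> 0"
    using assms(7)[of "((\<alpha>, 0), (\<alpha>, 0))" 1 0] ne by (auto intro: order_trans[OF abs_ge_zero])
  define N where "N = sup_norm ?\<Omega> a"
  have N: "\<bar>a z\<bar> \<le> N" if "z \<in> ?\<Omega>" for z
    unfolding N_def using compact a that by (rule abs_le_sup_norm)
  have N0: "N \<ge> 0" using N[OF ne] by linarith
  define \<Lambda> where "\<Lambda> = 1 + 2 * (N + \<beta> * M)"
  have \<Lambda>: "\<Lambda> \<ge> 1" "\<Lambda> \<ge> 2 * (N + \<beta> * M)"
    using N0 M \<beta> by (auto simp: \<Lambda>_def)
  define D where "D = sup_norm ?\<Omega> (\<lambda>z. u z - v z)"
  have uv: "\<bar>u z - v z\<bar> \<le> D" if "z \<in> ?\<Omega>" for z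
    unfolding D_def by (rule abs_le_sup_norm[OF compact _ that]) (intro continuous_intros u v)
  have D: "D \<ge> 0" using uv[OF ne] by linarith
  \<comment> \<open>At the end the error is at most \<open>4 * \<eta> * exp (\<Lambda> * T)\<close>,
    which this choice makes \<open>\<epsilon> / 2\<close>.\<close>
  define \<eta> where "\<eta> = \<epsilon> / (8 * exp (\<Lambda> * T))"
  have \<eta>: "\<eta> > 0" using \<epsilon> by (simp add: \<eta>_def)
  \<comment> \<open>The summand \<open>2 * \<eta>\<close> is the fixed point of
    \<open>e \<mapsto> e / 2 + \<eta>\<close>, so it survives each step while
    \<open>D / 2 ^ m\<close> is halved. For \<open>m = 0\<close> the list is empty and the iterate
    is \<open>v\<close> itself.\<close>
  have iter: "\<exists>n :: nat \<Rightarrow> nat. (\<forall>p\<in>{1..m}. n p \<ge> 1) \<and>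
      continuous_on ?\<Omega> (fold (\<lambda>p. ?G (n p)) [1..<Suc m] v) \<and>
      (\<forall>x t. (x, t) \<in> ?\<Omega> \<longrightarrow> \<bar>u (x, t) - fold (\<lambda>p. ?G (n p)) [1..<Suc m] v (x, t)\<bar>
        \<le> (D / 2 ^ m + 2 * \<eta>) * exp (\<Lambda> * t))" for m
  proof (induction m)
    case 0
    have "\<bar>u (x, t) - v (x, t)\<bar> \<le> (D + 2 * \<eta>) * exp (\<Lambda> * t)" if "(x, t) \<in> ?\<Omega>" for x t
    proof -
      have "(D + 2 * \<eta>) * 1 \<le> (D + 2 * \<eta>) * exp (\<Lambda> * t)"
        using D \<eta> \<Lambda>(1) that by (intro mult_left_mono) (auto simp: Omega_def)
      moreover have "\<bar>u (x, t) - v (x, t)\<bar> \<le> (D + 2 * \<eta>) * 1"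
        using uv[OF that] \<eta> by simp
      ultimately show ?thesis by (rule order_trans[rotated])
    qed
    then show ?case using v by simp
  next
    case (Suc m)
    then obtain n where n: "\<forall>p\<in>{1..m}. n p \<ge> 1"
      and cont: "continuous_on ?\<Omega> (fold (\<lambda>p. ?G (n p)) [1..<Suc m] v)"
      and err: "\<And>x t. (x, t) \<in> ?\<Omega> \<Longrightarrow> \<bar>u (x, t) - fold (\<lambda>p. ?G (n p)) [1..<Suc m] v (x, t)\<bar>
        \<le> (D / 2 ^ m + 2 * \<eta>) * exp (\<Lambda> * t)"
      by blast
    have D': "D / 2 ^ m + 2 * \<eta> \<ge> 0" using D \<eta> by simp
    have "\<exists>k\<ge>1. continuous_on ?\<Omega> (?G k (fold (\<lambda>p. ?G (n p)) [1..<Suc m] v)) \<and>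
      (\<forall>x t. (x, t) \<in> ?\<Omega> \<longrightarrow> \<bar>u (x, t) - ?G k (fold (\<lambda>p. ?G (n p)) [1..<Suc m] v) (x, t)\<bar>
        \<le> ((D / 2 ^ m + 2 * \<eta>) / 2 + \<eta>) * exp (\<Lambda> * t))"
      by (rule ex_G_op_halving_error[OF \<beta> a g u0 K assms(7-10) M N0 N \<Lambda> cont D' err \<eta>])
    then obtain k where k: "k \<ge> 1"
      "continuous_on ?\<Omega> (?G k (fold (\<lambda>p. ?G (n p)) [1..<Suc m] v))"
      "\<forall>x t. (x, t) \<in> ?\<Omega> \<longrightarrow> \<bar>u (x, t) - ?G k (fold (\<lambda>p. ?G (n p)) [1..<Suc m] v) (x, t)\<bar>
        \<le> ((D / 2 ^ m + 2 * \<eta>) / 2 + \<eta>) * exp (\<Lambda> * t)"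
      by (elim exE conjE)
    \<comment> \<open>Changing \<open>n\<close> only at \<open>Suc m\<close> leaves the first
      \<open>m\<close> operators as they were. Since \<open>fold\<close> applies the last list entry
      last, the new operator is the outermost one.\<close>
    define n' where "n' = n(Suc m := k)"
    have "fold (\<lambda>p. ?G (n' p)) [1..<Suc m] v = fold (\<lambda>p. ?G (n p)) [1..<Suc m] v"
      by (rule fold_cong) (auto simp: n'_def)
    then have step: "fold (\<lambda>p. ?G (n' p)) [1..<Suc (Suc m)] v =
        ?G k (fold (\<lambda>p. ?G (n p)) [1..<Suc m] v)"
      by (simp add: n'_def)
    have half: "(D / 2 ^ m + 2 * \<eta>) / 2 + \<eta> = D / 2 ^ Suc m + 2 * \<eta>"
      by (simp add: field_simps)
    have "\<forall>p\<in>{1..Suc m}. n' p \<ge> 1"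
      using n k(1) by (auto simp: n'_def)
    moreover note k(2)[folded step]
    moreover note k(3)[unfolded half, folded step]
    ultimately show ?case by (intro exI[of _ n'] conjI)
  qed
  have "(\<lambda>m. D * (1 / 2) ^ m) \<longlonglongrightarrow> D * 0"
    by (intro tendsto_intros LIMSEQ_power_zero) simp
  then have "\<forall>\<^sub>F m in sequentially. D * (1 / 2) ^ m < \<eta>"
    using \<eta> by (auto dest: order_tendstoD(2))
  from eventually_happens'[OF sequentially_bot eventually_conj[OF eventually_ge_at_top[of 1] this]]
  obtain m where m: "m \<ge> 1" "D / 2 ^ m < \<eta>"
    by (auto simp: power_one_over)
  obtain n where n: "\<forall>p\<in>{1..m}. n p \<ge> 1"
    and err: "\<And>x t. (x, t) \<in> ?\<Omega> \<Longrightarrow> \<bar>u (x, t) - fold (\<lambda>p. ?G (n p)) [1..<Suc m] v (x, t)\<bar>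
        \<le> (D / 2 ^ m + 2 * \<eta>) * exp (\<Lambda> * t)"
    using iter[of m] by blast
  have "\<bar>u z - fold (\<lambda>p. ?G (n p)) [1..<Suc m] v z\<bar> \<le> \<epsilon> / 2" if z: "z \<in> ?\<Omega>" for z
  proof -
    obtain x t where xt: "z = (x, t)" "(x, t) \<in> ?\<Omega>" using z by (cases z) auto
    have "\<bar>u z - fold (\<lambda>p. ?G (n p)) [1..<Suc m] v z\<bar> \<le> (D / 2 ^ m + 2 * \<eta>) * exp (\<Lambda> * t)"
      using err xt by blast
    \<comment> \<open>Here \<open>D / 2 ^ m < \<eta>\<close> bounds the first factor by
      \<open>3 * \<eta>\<close>, and \<open>t \<le> T\<close> removes the dependence on the
      point.\<close>
    also have "\<dots> \<le> (4 * \<eta>) * exp (\<Lambda> * T)"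
      using m(2) \<eta> D \<Lambda>(1) xt by (intro mult_mono) (auto simp: Omega_def)
    also have "\<dots> = \<epsilon> / 2" by (simp add: \<eta>_def)
    finally show ?thesis .
  qed
  \<comment> \<open>A supremum preserves only non-strict bounds; aiming at
    \<open>\<epsilon> / 2\<close> recovers the strict inequality.\<close>
  then have "sup_norm ?\<Omega> (\<lambda>z. u z - fold (\<lambda>p. ?G (n p)) [1..<Suc m] v z) \<le> \<epsilon> / 2"
    unfolding sup_norm_def using ne by (intro cSUP_least) auto
  also have "\<dots> < \<epsilon>" using \<epsilon> by simp
  finally show "\<exists>m\<ge>1. \<exists>n :: nat \<Rightarrow> nat. (\<forall>p\<in>{1..m}. n p \<ge> 1) \<and>
      sup_norm ?\<Omega> (\<lambda>z. u z - fold (\<lambda>p. ?G (n p)) [1..<Suc m] v z) < \<epsilon>"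
    using m(1) n by blast
qed

end
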